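(* Let $G:\mathbb{R}^p\to\mathbb{R}^p$ be a single-valued operator with $\mathrm{zer}(G)\neq\emptyset$ such that the following assumption holds: (a) there is $L=(L_1,\dots,L_n)\in[0,+\infty)^n$ with $\|[Gx]_i-[Gy]_i\|\le L_i\|x_i-y_i\|$ for all $x,y\in\mathrm{dom}(G)$ and all $i\in[n]$; (b) there exist $\rho=(\rho_1,\dots,\rho_n)\in[0,L]$ and $x^\star\in\mathrm{zer}(G)$ such that $\langle Gx,x-x^\star\rangle\ge-\sum_{i=1}^n\rho_i\|[Gx]_i\|^2$ for all $x\in\mathrm{dom}(G)$. Let $\{x^k\}$ be generated by the RCOG scheme, let $\mathcal{P}_k:=\|x^k-x^\star+\gamma\eta\circ Gx^{k-1}\|^2+\|x^k-x^{k-1}\|_\sigma^2$ for some $\sigma\in\mathbb{R}^n_{++}$, and let $\gamma_i$ be chosen such that $\frac{1+\sigma_i}{1+\sigma_i+\mathbf{p}_i}<\gamma_i<1$ for $i\in[n]$. Suppose that $$L_i\rho_i<\kappa_i\sqrt{\mathbf{p}_i}\Big[1-\tfrac{(1+\sigma_i)(1-\gamma_i)}{\gamma_i\mathbf{p}_i}\Big]\qquad\text{and}\qquad 0<\eta_i\le\frac{\kappa_i\sqrt{\mathbf{p}_i}}{\gamma_iL_i}$$ for all $i\in[n]$, where $\kappa_i^2:=\frac{\sigma_i}{2(1+\sigma_i)}$. Then $$\mathbb{E}[\mathcal{P}_{k+1}]\le\mathbb{E}[\mathcal{P}_k]-\sum_{i=1}^n\psi_i\,\mathbb{E}\big[\|[Gx^k]_i\|^2\big],$$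 where $$\psi_i:=2\gamma_i\eta_i(1-\gamma_i)\Big[\eta_i-\tfrac{\rho_i}{\gamma_i}-\tfrac{\eta_i(1+\sigma_i)(1-\gamma_i)}{\gamma_i\mathbf{p}_i}\Big]>0,\quad i\in[n].$$ Moreover, for $\psi_{\min}:=\min\{\psi_i:i\in[n]\}>0$, the following bound also holds: $$\frac{\psi_{\min}}{K+1}\sum_{k=0}^K\mathbb{E}\big[\|Gx^k\|^2\big]\le\frac{1}{K+1}\sum_{k=0}^K\sum_{i=1}^n\psi_i\,\mathbb{E}\big[\|[Gx^k]_i\|^2\big]\le\frac{3\|x^0-x^\star\|^2}{K+1}.$$
   Context: Vectors $x\in\mathbb{R}^p$ are decomposed into $n$ blocks $x=[x_1,\dots,x_n]$, $x_i\in\mathbb{R}^{p_i}$, $p_1+\dots+p_n=p$, $[n]=\{1,\dots,n\}$; $\|\cdot\|$ and $\langle\cdot,\cdot\rangle$ are the Euclidean norm and inner product. $\mathrm{dom}(G)$ is the domain of $G$ and $\mathrm{zer}(G)=\{x\in\mathbb{R}^p:Gx=0\}$. $[Gx]_i$ is the $i$-th block of $Gx$ and $G_{[i]}x:=[0,\dots,0,[Gx]_i,0,\dots,0]$ (only the $i$-th block is $[Gx]_i$, the others are zero). $\rho\in[0,L]$ means $0\le\rho_i\le L_i$ for each $i$. For $\sigma\in\mathbb{R}^n_{++}$ (vectors with positive entries), $\|x\|_\sigma^2:=\sum_{i=1}^n\sigma_i\|x_i\|^2$. For $\gamma=(\gamma_i)_{i=1}^n$ and $\eta=(\eta_i)_{i=1}^n$,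 $\gamma\eta\circ x:=[\gamma_1\eta_1x_1,\dots,\gamma_n\eta_nx_n]$. $\mathbb{E}[\cdot]$ is the total expectation. Probabilities: $\mathbf{p}_1,\dots,\mathbf{p}_n>0$ with $\sum_i\mathbf{p}_i=1$; the block indices $i_k\in[n]$ are sampled i.i.d. with $\mathbf{Prob}(i_k=i)=\mathbf{p}_i$. RCOG scheme (randomized block-coordinate optimistic gradient): given $x^0\in\mathrm{dom}(G)$, set $x^{-1}:=x^0$, and at each iteration $k\ge0$ sample $i_k$ and update $$x^{k+1}:=x^k-\tfrac{\eta_{i_k}}{\mathbf{p}_{i_k}}\big(G_{[i_k]}x^k-\gamma_{i_k}G_{[i_k]}x^{k-1}\big),$$ where $\eta_i>0$ and $\gamma_i\in(0,1)$, $i\in[n]$, are constants.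
   Formalization: ψ_i>0 fails for small η_i when ρ_i>0; it is replaced by: ψ_i>0 iff η_i>ρ_i/(γ_i[1-(1+σ_i)(1-γ_i)/(γ_i p_i)]), and ψ_min>0 iff this holds for all i; this threshold is below the upper bound on η_i if L_i>0. All the inequalities hold as stated. *)

theory Defs
  imports "HOL-Probability.Probability"
begin

(* The coordinates 'p of R^p are assigned to the blocks 'n by blk, so p_i is the number of
   j with blk j = i. The block x_i is represented by its zero-padding in R^p, which is the
   vector written with subscript [i]; norm_block_sq shows that the norm is that of x_i. *)
definition block :: "('p \<Rightarrow> 'n) \<Rightarrow> 'n \<Rightarrow> real ^ 'p \<Rightarrow> real ^ 'p" where
  "block blk i x = (\<chi> j. if blk j = i then x $ j else 0)"

lemma norm_block_sq:
  fixes x :: "real ^ 'p"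
  shows "(norm (block blk i x))\<^sup>2 = (\<Sum>j | blk j = i. (x $ j)\<^sup>2)"
proof -
  have "(norm (block blk i x))\<^sup>2 = (\<Sum>j\<in>UNIV. (block blk i x $ j)\<^sup>2)"
    by (simp add: norm_vec_def L2_set_def sum_nonneg)
  also have "\<dots> = (\<Sum>j\<in>UNIV. if blk j = i then (x $ j)\<^sup>2 else 0)"
    by (intro sum.cong) (auto simp: block_def)
  also have "\<dots> = (\<Sum>j | blk j = i. (x $ j)\<^sup>2)"
    by (simp add: sum.If_cases)
  finally show ?thesis .
qed

definition block_scale :: "('p \<Rightarrow> 'n) \<Rightarrow> ('n \<Rightarrow> real) \<Rightarrow> real ^ 'p \<Rightarrow> real ^ 'p" where
  "block_scale blk c x = (\<chi> j. c (blk j) * x $ j)"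

definition weighted_norm_sq :: "('p \<Rightarrow> 'n::finite) \<Rightarrow> ('n \<Rightarrow> real) \<Rightarrow> real ^ 'p \<Rightarrow> real" where
  "weighted_norm_sq blk \<sigma> x = (\<Sum>i\<in>UNIV. \<sigma> i * (norm (block blk i x))\<^sup>2)"

definition zer :: "(real ^ 'p \<Rightarrow> real ^ 'p) \<Rightarrow> (real ^ 'p) set" where
  "zer G = {x. G x = 0}"

definition block_lipschitz ::
  "('p \<Rightarrow> 'n) \<Rightarrow> (real ^ 'p \<Rightarrow> real ^ 'p) \<Rightarrow> ('n \<Rightarrow> real) \<Rightarrow> bool" where
  "block_lipschitz blk G L \<longleftrightarrow>
     (\<forall>x y i. norm (block blk i (G x) - block blk i (G y)) \<le> L i * norm (block blk i x - block blk i y))"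

definition weak_minty ::
  "('p \<Rightarrow> 'n::finite) \<Rightarrow> (real ^ 'p \<Rightarrow> real ^ 'p) \<Rightarrow> ('n \<Rightarrow> real) \<Rightarrow> real ^ 'p \<Rightarrow> bool" where
  "weak_minty blk G \<rho> xstar \<longleftrightarrow>
     (\<forall>x. G x \<bullet> (x - xstar) \<ge> - (\<Sum>i\<in>UNIV. \<rho> i * (norm (block blk i (G x)))\<^sup>2))"

(* X^(k-1), with the convention X^(-1) = X^0 *)
definition prev :: "(nat \<Rightarrow> 'a) \<Rightarrow> nat \<Rightarrow> 'a" where
  "prev X k = (case k of 0 \<Rightarrow> X 0 | Suc m \<Rightarrow> X m)"

(* X is the trajectory produced by the sequence b of sampled blocks *)
definition rcog ::
  "('p \<Rightarrow> 'n) \<Rightarrow> (real ^ 'p \<Rightarrow> real ^ 'p) \<Rightarrow> ('n \<Rightarrow> real) \<Rightarrow> ('n \<Rightarrow> real) \<Rightarrow> ('n \<Rightarrow> real) \<Rightarrow>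
   real ^ 'p \<Rightarrow> (nat \<Rightarrow> 'n) \<Rightarrow> (nat \<Rightarrow> real ^ 'p) \<Rightarrow> bool" where
  "rcog blk G pr \<eta> \<gamma> x0 b X \<longleftrightarrow>
     X 0 = x0 \<and>
     (\<forall>k. X (Suc k) = X k - (\<eta> (b k) / pr (b k)) *\<^sub>R
        (block blk (b k) (G (X k)) - \<gamma> (b k) *\<^sub>R block blk (b k) (G (prev X k))))"

definition potential ::
  "('p \<Rightarrow> 'n::finite) \<Rightarrow> (real ^ 'p \<Rightarrow> real ^ 'p) \<Rightarrow> ('n \<Rightarrow> real) \<Rightarrow> ('n \<Rightarrow> real) \<Rightarrow> ('n \<Rightarrow> real) \<Rightarrow>
   real ^ 'p \<Rightarrow> (nat \<Rightarrow> real ^ 'p) \<Rightarrow> nat \<Rightarrow> real" where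
  "potential blk G \<eta> \<gamma> \<sigma> xstar X k =
     (norm (X k - xstar + block_scale blk (\<lambda>i. \<gamma> i * \<eta> i) (G (prev X k))))\<^sup>2
     + weighted_norm_sq blk \<sigma> (X k - prev X k)"

definition kappa :: "real \<Rightarrow> real" where
  "kappa s = sqrt (s / (2 * (1 + s)))"

definition psi ::
  "('n \<Rightarrow> real) \<Rightarrow> ('n \<Rightarrow> real) \<Rightarrow> ('n \<Rightarrow> real) \<Rightarrow> ('n \<Rightarrow> real) \<Rightarrow> ('n \<Rightarrow> real) \<Rightarrow> 'n \<Rightarrow> real" where
  "psi pr \<eta> \<gamma> \<sigma> \<rho> i =
     2 * \<gamma> i * \<eta> i * (1 - \<gamma> i) *
       (\<eta> i - \<rho> i / \<gamma> i - \<eta> i * (1 + \<sigma> i) * (1 - \<gamma> i) / (\<gamma> i * pr i))"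

(* The step size at which the bracket in psi vanishes. A positive step size alone does not
   make psi positive when the weak Minty constant of the block is positive. *)
definition eta_low ::
  "('n \<Rightarrow> real) \<Rightarrow> ('n \<Rightarrow> real) \<Rightarrow> ('n \<Rightarrow> real) \<Rightarrow> ('n \<Rightarrow> real) \<Rightarrow> 'n \<Rightarrow> real" where
  "eta_low pr \<gamma> \<sigma> \<rho> i = \<rho> i / (\<gamma> i * (1 - (1 + \<sigma> i) * (1 - \<gamma> i) / (\<gamma> i * pr i)))"

end

theory Submission
  imports Defs
begin

text \<open>
  The block-wise Lipschitz condition makes the operator separable: the \<open>i\<close>-th block of \<open>G x\<close>
  depends only on the \<open>i\<close>-th block of \<open>x\<close>. Hence the weak Minty inequality holds in each block
  separately, and may be weighted by the block-dependent factor \<open>\<eta> i * (1 - \<gamma> i)\<close>. Conditionally on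
  the past, one step changes the potential by a sum over blocks, and each summand is estimated by
  writing \<open>\<eta> (g - \<gamma> h) = \<eta> (1 - \<gamma>) g + e\<close> with \<open>e = \<gamma> \<eta> (g - h)\<close>, where the Lipschitz bound
  on \<open>e\<close> is absorbed by the \<open>\<sigma>\<close>-weighted term. The state at time \<open>k\<close> is a function of
  the finitely many indices sampled before, which are independent of the fresh index.
\<close>

section \<open>Blocks as orthogonal components of the space\<close>

lemma block_add: "block blk i (x + y) = block blk i x + block blk i y"
  by (simp add: block_def vec_eq_iff)

lemma block_diff: "block blk i (x - y) = block blk i x - block blk i y"
  by (simp add: block_def vec_eq_iff)

lemma block_scaleR: "block blk i (c *\<^sub>R x) = c *\<^sub>R block blk i x"
  by (simp add: block_def vec_eq_iff)

lemma block_minus: "block blk i (- x) = - block blk i x"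
  by (simp add: block_def vec_eq_iff)

lemma block_zero [simp]: "block blk i 0 = 0"
  by (simp add: block_def vec_eq_iff)

lemma block_block: "block blk i (block blk j x) = (if i = j then block blk i x else 0)"
  by (simp add: block_def vec_eq_iff)

lemma block_block_scale: "block blk i (block_scale blk c x) = c i *\<^sub>R block blk i x"
  by (simp add: block_def block_scale_def vec_eq_iff)

lemmas block_simps = block_add block_diff block_scaleR block_minus block_block block_block_scale

lemma inner_eq_sum_block:
  fixes blk :: "'p::finite \<Rightarrow> 'n::finite"
  shows "x \<bullet> y = (\<Sum>i\<in>UNIV. block blk i x \<bullet> block blk i y)"
proof -
  have "(\<Sum>i\<in>UNIV. block blk i x \<bullet> block blk i y)
      = (\<Sum>j\<in>UNIV. \<Sum>i\<in>UNIV. if i = blk j then x $ j * y $ j else 0)"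
    by (subst sum.swap) (auto simp: block_def inner_vec_def intro!: sum.cong)
  then show ?thesis
    by (simp add: inner_vec_def)
qed

lemma norm_sq_eq_sum_block:
  fixes blk :: "'p::finite \<Rightarrow> 'n::finite"
  shows "(norm x)\<^sup>2 = (\<Sum>i\<in>UNIV. (norm (block blk i x))\<^sup>2)"
  unfolding power2_norm_eq_inner by (rule inner_eq_sum_block)

lemma norm_add_sq_le:
  fixes x y :: "'a::real_inner"
  shows "(norm (x + y))\<^sup>2 \<le> 2 * (norm x)\<^sup>2 + 2 * (norm y)\<^sup>2"
  using zero_le_power2[of "norm (x - y)"]
  by (simp add: power2_norm_eq_inner inner_simps inner_commute)

text \<open>The inequality is tested at a point \<open>y\<close> that agrees with \<open>x\<close>
  in block \<open>i\<close> and with \<open>xstar\<close> in all other blocks. By the Lipschitz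
  condition \<open>G y\<close> then has the \<open>i\<close>-th block of \<open>G x\<close>, and its
  other blocks are those of \<open>G xstar\<close>, which are zero; both sums collapse to one
  term.\<close>

lemma block_weak_minty:
  fixes blk :: "'p::finite \<Rightarrow> 'n::finite"
  assumes "block_lipschitz blk G L" "weak_minty blk G \<rho> xstar" "xstar \<in> zer G"
  shows "block blk i (G x) \<bullet> block blk i (x - xstar) \<ge> - \<rho> i * (norm (block blk i (G x)))\<^sup>2"
proof -
  define y where "y = xstar + block blk i (x - xstar)"
  have yb: "block blk j y = (if j = i then block blk i x else block blk j xstar)" for j
    by (simp add: y_def block_simps)
  have "norm (block blk i (G y) - block blk i (G x)) \<le> L i * norm (block blk i y - block blk i x)"
    using assms(1) unfolding block_lipschitz_def by blast
  then have Gi: "block blk i (G y) = block blk i (G x)"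
    by (simp add: yb)
  have Gj: "block blk j (G y) = 0" if "j \<noteq> i" for j
  proof -
    have "norm (block blk j (G y) - block blk j (G xstar)) \<le> L j * norm (block blk j y - block blk j xstar)"
      using assms(1) unfolding block_lipschitz_def by blast
    then show ?thesis
      using that assms(3) by (simp add: yb zer_def)
  qed
  have "G y \<bullet> (y - xstar) = (\<Sum>j\<in>UNIV. if j = i then block blk i (G x) \<bullet> block blk i (x - xstar) else 0)"
    unfolding inner_eq_sum_block[of "G y" _ blk]
    by (intro sum.cong) (auto simp: Gi Gj yb block_diff)
  moreover have "(\<Sum>j\<in>UNIV. \<rho> j * (norm (block blk j (G y)))\<^sup>2)
      = (\<Sum>j\<in>UNIV. if j = i then \<rho> i * (norm (block blk i (G x)))\<^sup>2 else 0)"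
    by (intro sum.cong) (auto simp: Gi Gj)
  moreover have "G y \<bullet> (y - xstar) \<ge> - (\<Sum>j\<in>UNIV. \<rho> j * (norm (block blk j (G y)))\<^sup>2)"
    using assms(2) unfolding weak_minty_def by blast
  ultimately show ?thesis by simp
qed

section \<open>The estimate in a single block\<close>

lemma kappa_sq: "0 < s \<Longrightarrow> (kappa s)\<^sup>2 = s / (2 * (1 + s))"
  by (simp add: kappa_def)

text \<open>In the application \<open>v\<close>, \<open>g\<close>, \<open>h\<close>,
  \<open>d\<close> are the \<open>i\<close>-th blocks of \<open>x^k - xstar\<close>,
  \<open>G x^k\<close>, \<open>G x^(k-1)\<close> and \<open>x^k - x^(k-1)\<close>, and
  \<open>p\<close> is the probability of drawing block \<open>i\<close>. The left side is the
  expected contribution of this block after one step: with probability \<open>1 - p\<close> the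
  block stays put, its displacement is zero, and it contributes only
  \<open>(norm U)^2\<close>.\<close>

lemma block_descent:
  fixes v g h d :: "'a::real_inner"
  assumes p: "0 < p" and s: "0 < s" and gam: "0 < \<gamma>" "\<gamma> < 1" and eta: "0 < \<eta>"
    and minty: "g \<bullet> v \<ge> - \<rho> * (norm g)\<^sup>2"
    and lip: "(norm ((\<gamma> * \<eta>) *\<^sub>R (g - h)))\<^sup>2 \<le> (kappa s)\<^sup>2 * p * (norm d)\<^sup>2"
    and U: "U = v + (\<gamma> * \<eta>) *\<^sub>R g" and D: "D = \<eta> *\<^sub>R (g - \<gamma> *\<^sub>R h)"
  shows "(norm U)\<^sup>2 + p * ((norm (U - (1 / p) *\<^sub>R D))\<^sup>2 + s * (norm ((1 / p) *\<^sub>R D))\<^sup>2 - (norm U)\<^sup>2)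
    \<le> (norm (v + (\<gamma> * \<eta>) *\<^sub>R h))\<^sup>2 + s * (norm d)\<^sup>2
      - 2 * \<gamma> * \<eta> * (1 - \<gamma>) * (\<eta> - \<rho> / \<gamma> - \<eta> * (1 + s) * (1 - \<gamma>) / (\<gamma> * p)) * (norm g)\<^sup>2"
proof -
  define e where "e = (\<gamma> * \<eta>) *\<^sub>R (g - h)"
  have De: "D = (\<eta> * (1 - \<gamma>)) *\<^sub>R g + e"
    by (simp add: D e_def algebra_simps)
  have "(norm D)\<^sup>2 \<le> 2 * (norm ((\<eta> * (1 - \<gamma>)) *\<^sub>R g))\<^sup>2 + 2 * (norm e)\<^sup>2"
    unfolding De by (rule norm_add_sq_le)
  also have "\<dots> = 2 * (\<eta> * (1 - \<gamma>))\<^sup>2 * (norm g)\<^sup>2 + 2 * (norm e)\<^sup>2"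
    by (simp add: power_mult_distrib)
  finally have "(1 + s) / p * (norm D)\<^sup>2
      \<le> (1 + s) / p * (2 * (\<eta> * (1 - \<gamma>))\<^sup>2 * (norm g)\<^sup>2 + 2 * (norm e)\<^sup>2)"
    using p s by (intro mult_left_mono) auto
  \<comment> \<open>The constant \<open>kappa s\<close> is made for this:
    \<open>2 * (1 + s) / p\<close> times \<open>(kappa s)^2 * p\<close> is exactly
    \<open>s\<close>.\<close>
  moreover have "2 * (1 + s) / p * (norm e)\<^sup>2 \<le> s * (norm d)\<^sup>2"
  proof -
    have "2 * (1 + s) / p * (norm e)\<^sup>2 \<le> 2 * (1 + s) / p * ((kappa s)\<^sup>2 * p * (norm d)\<^sup>2)"
      using lip p s unfolding e_def by (intro mult_left_mono) auto
    also have "\<dots> = s * (norm d)\<^sup>2"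
      using p s by (simp add: kappa_sq add_pos_pos less_imp_neq[symmetric])
    finally show ?thesis .
  qed
  \<comment> \<open>Since \<open>v + (\<gamma> * \<eta>) *\<^sub>R h\<close> is \<open>U - e\<close>
    and \<open>D\<close> contains \<open>e\<close> with coefficient one, the inner products of
    \<open>U\<close> with \<open>e\<close> cancel. What remains involves only \<open>g\<close>,
    \<open>v\<close> and \<open>- (norm e)^2\<close>.\<close>
  moreover have "(norm U)\<^sup>2 - 2 * (U \<bullet> D) - (norm (v + (\<gamma> * \<eta>) *\<^sub>R h))\<^sup>2
      = - (norm e)\<^sup>2 - 2 * \<eta> * (1 - \<gamma>) * (g \<bullet> v) - 2 * \<gamma> * \<eta>\<^sup>2 * (1 - \<gamma>) * (norm g)\<^sup>2"
    unfolding power2_norm_eq_inner U D e_def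
    by (simp add: inner_simps inner_commute algebra_simps power2_eq_square)
  moreover have "p * ((norm (U - (1 / p) *\<^sub>R D))\<^sup>2 + s * (norm ((1 / p) *\<^sub>R D))\<^sup>2 - (norm U)\<^sup>2)
      = - 2 * (U \<bullet> D) + (1 + s) / p * (norm D)\<^sup>2"
    unfolding power2_norm_eq_inner using p
    by (simp add: inner_simps inner_commute field_simps power2_eq_square)
  moreover have "2 * \<eta> * (1 - \<gamma>) * (g \<bullet> v) \<ge> 2 * \<eta> * (1 - \<gamma>) * (- \<rho> * (norm g)\<^sup>2)"
    using gam eta minty by (intro mult_left_mono) auto
  moreover have "2 * \<gamma> * \<eta> * (1 - \<gamma>) * (\<eta> - \<rho> / \<gamma> - \<eta> * (1 + s) * (1 - \<gamma>) / (\<gamma> * p)) * (norm g)\<^sup>2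
      = 2 * \<gamma> * \<eta>\<^sup>2 * (1 - \<gamma>) * (norm g)\<^sup>2 - 2 * \<eta> * (1 - \<gamma>) * \<rho> * (norm g)\<^sup>2
        - (1 + s) / p * (2 * (\<eta> * (1 - \<gamma>))\<^sup>2 * (norm g)\<^sup>2)"
    using gam p by (simp add: field_simps power2_eq_square)
  moreover have "(1 + s) / p * (2 * (\<eta> * (1 - \<gamma>))\<^sup>2 * (norm g)\<^sup>2 + 2 * (norm e)\<^sup>2)
      = (1 + s) / p * (2 * (\<eta> * (1 - \<gamma>))\<^sup>2 * (norm g)\<^sup>2) + 2 * (1 + s) / p * (norm e)\<^sup>2"
    by (simp add: distrib_left)
  \<comment> \<open>The term \<open>- (norm e)^2\<close> left by the cancellation has the favourable
    sign and is discarded.\<close>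
  moreover have "0 \<le> (norm e)\<^sup>2" by simp
  ultimately show ?thesis by argo
qed

section \<open>Expectations over finitely many sampled indices\<close>

context prob_space
begin

text \<open>The first \<open>k\<close> indices form a tuple from a finite set with the discrete
  sigma-algebra, so any real function of the tuple, however irregular, is measurable and bounded.
  Integrability of all quantities along the scheme comes from here.\<close>

lemma integrable_past:
  fixes I :: "nat \<Rightarrow> 'a \<Rightarrow> 'n::finite" and f :: "(nat \<Rightarrow> 'n) \<Rightarrow> real"
  assumes I: "\<And>j. random_variable (count_space UNIV) (I j)"
  shows "integrable M (\<lambda>\<omega>. f (\<lambda>j\<in>{..<k}. I j \<omega>))"
proof -
  let ?S = "{..<k} \<rightarrow>\<^sub>E (UNIV :: 'n set)"
  have P: "PiM {..<k} (\<lambda>_. count_space (UNIV :: 'n set)) = count_space ?S"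
    by (rule count_space_PiM_finite) auto
  have "(\<lambda>\<omega>. \<lambda>j\<in>{..<k}. I j \<omega>) \<in> M \<rightarrow>\<^sub>M PiM {..<k} (\<lambda>_. count_space UNIV)"
    by (intro measurable_restrict I)
  then have Z: "(\<lambda>\<omega>. \<lambda>j\<in>{..<k}. I j \<omega>) \<in> M \<rightarrow>\<^sub>M count_space ?S"
    by (simp only: P)
  have fin: "finite (f ` ?S)"
    by (intro finite_imageI finite_PiE) auto
  then obtain B where B: "\<And>y. y \<in> f ` ?S \<Longrightarrow> norm y \<le> B"
    using finite_imp_bounded bounded_iff by metis
  show ?thesis
  proof (rule integrable_const_bound)
    show "AE \<omega> in M. norm (f (\<lambda>j\<in>{..<k}. I j \<omega>)) \<le> B"
      by (intro AE_I2 B imageI PiE_I) auto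
    show "(\<lambda>\<omega>. f (\<lambda>j\<in>{..<k}. I j \<omega>)) \<in> borel_measurable M"
      by (rule measurable_compose[OF Z]) auto
  qed
qed

text \<open>This takes the place of conditioning on the past. The integrand is split according to
  the value of \<open>I k\<close>, and independence factors each product of a function of the past
  and the indicator of \<open>I k = i\<close>.\<close>

lemma expectation_fresh_index:
  fixes I :: "nat \<Rightarrow> 'a \<Rightarrow> 'n::finite" and f :: "(nat \<Rightarrow> 'n) \<Rightarrow> 'n \<Rightarrow> real"
  assumes indep: "indep_vars (\<lambda>_. count_space UNIV) I UNIV"
  shows "expectation (\<lambda>\<omega>. f (\<lambda>j\<in>{..<k}. I j \<omega>) (I k \<omega>))
    = (\<Sum>i\<in>UNIV. prob {\<omega> \<in> space M. I k \<omega> = i} * expectation (\<lambda>\<omega>. f (\<lambda>j\<in>{..<k}. I j \<omega>) i))"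
proof -
  have I: "random_variable (count_space UNIV) (I j)" for j
    using indep by (simp add: indep_vars_def)
  have P: "PiM {..<k} (\<lambda>_. count_space (UNIV :: 'n set)) = count_space ({..<k} \<rightarrow>\<^sub>E UNIV)"
    by (rule count_space_PiM_finite) auto
  \<comment> \<open>Independence is applied to the disjoint index sets \<open>{..<k}\<close> and
    \<open>{k}\<close>. The fresh index therefore appears as a tuple with one entry, whose component
    the indicator reads below.\<close>
  have ind: "indep_var (PiM {..<k} (\<lambda>_. count_space UNIV)) (\<lambda>\<omega>. \<lambda>j\<in>{..<k}. I j \<omega>)
      (PiM {k} (\<lambda>_. count_space UNIV)) (\<lambda>\<omega>. \<lambda>j\<in>{k}. I j \<omega>)"
    by (rule indep_var_restrict[OF indep]) auto
  have meas: "(\<lambda>\<omega>. indicator {i} (I k \<omega>) :: real) \<in> borel_measurable M" for i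
    by (rule measurable_compose[OF I]) auto
  have ev: "{\<omega> \<in> space M. I k \<omega> = i} \<in> events" for i
    using I by measurable
  have int_ind: "integrable M (\<lambda>\<omega>. indicator {i} (I k \<omega>) :: real)" for i
    by (rule integrable_const_bound[of _ 1]) (use meas in \<open>auto simp: indicator_def\<close>)
  have E_ind: "expectation (\<lambda>\<omega>. indicator {i} (I k \<omega>)) = prob {\<omega> \<in> space M. I k \<omega> = i}" for i
  proof -
    have "expectation (\<lambda>\<omega>. indicator {i} (I k \<omega>) :: real)
        = expectation (indicator {\<omega> \<in> space M. I k \<omega> = i})"
      by (intro Bochner_Integration.integral_cong) (auto simp: indicator_def)
    then show ?thesis using ev by simp
  qed
  have indi: "indep_var borel (\<lambda>\<omega>. f (\<lambda>j\<in>{..<k}. I j \<omega>) i)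
      borel (\<lambda>\<omega>. indicator {i} (I k \<omega>) :: real)" for i
  proof -
    have "(\<lambda>z. indicator {i} (z k) :: real) \<in> PiM {k} (\<lambda>_. count_space UNIV) \<rightarrow>\<^sub>M borel"
      by (rule measurable_compose[OF measurable_component_singleton[of k]]) auto
    moreover have "(\<lambda>z. f z i) \<in> PiM {..<k} (\<lambda>_. count_space UNIV) \<rightarrow>\<^sub>M borel"
      unfolding P by simp
    ultimately show ?thesis
      using indep_var_compose[OF ind, of "\<lambda>z. f z i" borel "\<lambda>z. indicator {i} (z k)" borel]
      by (simp add: o_def)
  qed
  have "expectation (\<lambda>\<omega>. f (\<lambda>j\<in>{..<k}. I j \<omega>) (I k \<omega>))
      = expectation (\<lambda>\<omega>. \<Sum>i\<in>UNIV. f (\<lambda>j\<in>{..<k}. I j \<omega>) i * indicator {i} (I k \<omega>))"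
    by (simp add: indicator_def)
  also have "\<dots> = (\<Sum>i\<in>UNIV. expectation (\<lambda>\<omega>. f (\<lambda>j\<in>{..<k}. I j \<omega>) i * indicator {i} (I k \<omega>)))"
    by (intro Bochner_Integration.integral_sum indep_var_integrable[OF indi] integrable_past I int_ind)
  also have "\<dots> = (\<Sum>i\<in>UNIV. prob {\<omega> \<in> space M. I k \<omega> = i} * expectation (\<lambda>\<omega>. f (\<lambda>j\<in>{..<k}. I j \<omega>) i))"
    by (intro sum.cong refl, subst indep_var_lebesgue_integral[OF indi])
       (auto intro!: integrable_past I int_ind simp: E_ind)
  finally show ?thesis .
qed

end


section \<open>The scheme as iteration of a state map\<close>

text \<open>A state is the pair of the current and the previous iterate.\<close>

definition rcog_step ::
  "('p \<Rightarrow> 'n) \<Rightarrow> (real ^ 'p \<Rightarrow> real ^ 'p) \<Rightarrow> ('n \<Rightarrow> real) \<Rightarrow> ('n \<Rightarrow> real) \<Rightarrow> ('n \<Rightarrow> real) \<Rightarrow>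
   'n \<Rightarrow> (real ^ 'p) \<times> (real ^ 'p) \<Rightarrow> (real ^ 'p) \<times> (real ^ 'p)" where
  "rcog_step blk G pr \<eta> \<gamma> i s =
     (fst s - (\<eta> i / pr i) *\<^sub>R (block blk i (G (fst s)) - \<gamma> i *\<^sub>R block blk i (G (snd s))), fst s)"

text \<open>With the indices as an explicit argument the state is a deterministic function, to which
  the probabilistic lemmas apply. The starting pair repeats \<open>x0\<close> because of the
  convention x^(-1) = x^0.\<close>

primrec rcog_state ::
  "('p \<Rightarrow> 'n) \<Rightarrow> (real ^ 'p \<Rightarrow> real ^ 'p) \<Rightarrow> ('n \<Rightarrow> real) \<Rightarrow> ('n \<Rightarrow> real) \<Rightarrow> ('n \<Rightarrow> real) \<Rightarrow>
   real ^ 'p \<Rightarrow> (nat \<Rightarrow> 'n) \<Rightarrow> nat \<Rightarrow> (real ^ 'p) \<times> (real ^ 'p)" where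
  "rcog_state blk G pr \<eta> \<gamma> x0 b 0 = (x0, x0)"
| "rcog_state blk G pr \<eta> \<gamma> x0 b (Suc k) = rcog_step blk G pr \<eta> \<gamma> (b k) (rcog_state blk G pr \<eta> \<gamma> x0 b k)"

text \<open>The potential has to be evaluated at every possible successor of a state, not only along
  the sampled trajectory; hence a version with the pair as argument.\<close>

definition state_potential ::
  "('p \<Rightarrow> 'n::finite) \<Rightarrow> (real ^ 'p \<Rightarrow> real ^ 'p) \<Rightarrow> ('n \<Rightarrow> real) \<Rightarrow> ('n \<Rightarrow> real) \<Rightarrow> ('n \<Rightarrow> real) \<Rightarrow>
   real ^ 'p \<Rightarrow> (real ^ 'p) \<times> (real ^ 'p) \<Rightarrow> real" where
  "state_potential blk G \<eta> \<gamma> \<sigma> xstar s =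
     (norm (fst s - xstar + block_scale blk (\<lambda>i. \<gamma> i * \<eta> i) (G (snd s))))\<^sup>2
     + weighted_norm_sq blk \<sigma> (fst s - snd s)"

lemma rcog_state_eq:
  assumes "rcog blk G pr \<eta> \<gamma> x0 b X"
  shows "rcog_state blk G pr \<eta> \<gamma> x0 b k = (X k, prev X k)"
  using assms by (induction k) (simp_all add: rcog_def prev_def rcog_step_def)

lemma potential_eq_state_potential:
  "potential blk G \<eta> \<gamma> \<sigma> xstar X k = state_potential blk G \<eta> \<gamma> \<sigma> xstar (X k, prev X k)"
  by (simp add: potential_def state_potential_def)

text \<open>Permits cutting the index sequence down to a tuple on \<open>{..<k}\<close>, the form in
  which the past enters \<open>integrable_past\<close> and
  \<open>expectation_fresh_index\<close>.\<close>

lemma rcog_state_cong: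
  "(\<And>j. j < k \<Longrightarrow> b j = b' j) \<Longrightarrow> rcog_state blk G pr \<eta> \<gamma> x0 b k = rcog_state blk G pr \<eta> \<gamma> x0 b' k"
  by (induction k) simp_all

section \<open>Parameter bounds and conditional descent of the potential\<close>

locale rcog_parameters =
  fixes blk :: "'p::finite \<Rightarrow> 'n::finite"
    and G :: "real ^ 'p \<Rightarrow> real ^ 'p"
    and L \<rho> \<sigma> \<gamma> \<eta> pr :: "'n \<Rightarrow> real"
    and xstar :: "real ^ 'p"
  assumes lipschitz: "block_lipschitz blk G L"
    and xstar: "xstar \<in> zer G"
    and minty: "weak_minty blk G \<rho> xstar"
    and L_nonneg: "\<And>i. 0 \<le> L i"
    and pr_pos: "\<And>i. 0 < pr i"
    and pr_sum: "(\<Sum>i\<in>UNIV. pr i) = 1"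
    and sigma_pos: "\<And>i. 0 < \<sigma> i"
    and gamma_range: "\<And>i. (1 + \<sigma> i) / (1 + \<sigma> i + pr i) < \<gamma> i \<and> \<gamma> i < 1"
    and eta_pos: "\<And>i. 0 < \<eta> i"
    and eta_upper: "\<And>i. 0 < L i \<Longrightarrow> \<eta> i \<le> kappa (\<sigma> i) * sqrt (pr i) / (\<gamma> i * L i)"
begin

lemma gamma_pos: "0 < \<gamma> i"
proof -
  have "0 < (1 + \<sigma> i) / (1 + \<sigma> i + pr i)"
    using sigma_pos[of i] pr_pos[of i] by simp
  then show ?thesis using gamma_range[of i] by linarith
qed

text \<open>Clearing denominators turns the lower bound on \<open>\<gamma> i\<close> into exactly
  this inequality.\<close>

lemma optimism_ratio_less_1: "(1 + \<sigma> i) * (1 - \<gamma> i) / (\<gamma> i * pr i) < 1"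
  using gamma_range[of i] sigma_pos[of i] pr_pos[of i] gamma_pos[of i]
  by (simp add: divide_simps algebra_simps split: if_splits)

text \<open>The step size bound in a multiplied form that also covers \<open>L i = 0\<close>. There
  the quotient in \<open>eta_upper\<close> would be zero in HOL although the intended bound is
  infinite, which is why \<open>eta_upper\<close> speaks only of positive
  \<open>L i\<close>.\<close>

lemma gamma_eta_L_le: "\<gamma> i * \<eta> i * L i \<le> kappa (\<sigma> i) * sqrt (pr i)"
proof (cases "L i = 0")
  case True
  then show ?thesis
    using sigma_pos[of i] pr_pos[of i] by (simp add: kappa_def)
next
  case False
  then have "0 < L i" using L_nonneg[of i] by simp
  then show ?thesis
    using eta_upper[of i] gamma_pos[of i] by (simp add: pos_le_divide_eq mult_ac)
qed

text \<open>Supplies the premise \<open>lip\<close> of \<open>block_descent\<close>. Taken at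
  \<open>xstar\<close>, where \<open>G\<close> vanishes, it also bounds the initial
  potential.\<close>

lemma scaled_increment_le:
  "(norm ((\<gamma> i * \<eta> i) *\<^sub>R (block blk i (G x) - block blk i (G y))))\<^sup>2
    \<le> (kappa (\<sigma> i))\<^sup>2 * pr i * (norm (block blk i (x - y)))\<^sup>2"
proof -
  have "norm ((\<gamma> i * \<eta> i) *\<^sub>R (block blk i (G x) - block blk i (G y)))
      = \<gamma> i * \<eta> i * norm (block blk i (G x) - block blk i (G y))"
    using gamma_pos[of i] eta_pos[of i] by (simp add: abs_mult)
  also have "\<dots> \<le> \<gamma> i * \<eta> i * (L i * norm (block blk i x - block blk i y))"
    using lipschitz gamma_pos[of i] eta_pos[of i]
    by (intro mult_left_mono) (auto simp: block_lipschitz_def)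
  also have "\<dots> = \<gamma> i * \<eta> i * L i * norm (block blk i (x - y))"
    by (simp add: block_diff)
  also have "\<dots> \<le> kappa (\<sigma> i) * sqrt (pr i) * norm (block blk i (x - y))"
    by (intro mult_right_mono gamma_eta_L_le) simp
  finally have "(norm ((\<gamma> i * \<eta> i) *\<^sub>R (block blk i (G x) - block blk i (G y))))\<^sup>2
      \<le> (kappa (\<sigma> i) * sqrt (pr i) * norm (block blk i (x - y)))\<^sup>2"
    by (rule power_mono) simp
  then show ?thesis
    using pr_pos[of i] by (simp add: power_mult_distrib)
qed

text \<open>The left side is the conditional expectation of the next potential given the state
  \<open>s\<close>. Drawing \<open>j\<close> moves only block \<open>j\<close>, so averaging over
  \<open>j\<close> weights the change in each block by its own probability, and
  \<open>block_descent\<close> applies block by block.\<close>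

lemma state_potential_step_le:
  "(\<Sum>i\<in>UNIV. pr i * state_potential blk G \<eta> \<gamma> \<sigma> xstar (rcog_step blk G pr \<eta> \<gamma> i s))
    \<le> state_potential blk G \<eta> \<gamma> \<sigma> xstar s
      - (\<Sum>i\<in>UNIV. psi pr \<eta> \<gamma> \<sigma> \<rho> i * (norm (block blk i (G (fst s))))\<^sup>2)"
proof -
  obtain y z where s: "s = (y, z)" by (cases s)
  define g where "g i = block blk i (G y)" for i
  define h where "h i = block blk i (G z)" for i
  define v where "v i = block blk i (y - xstar)" for i
  define D where "D i = \<eta> i *\<^sub>R (g i - \<gamma> i *\<^sub>R h i)" for i
  \<comment> \<open>\<open>U\<close> contains \<open>g\<close> and not \<open>h\<close>: after the
    step the previous iterate is \<open>y\<close>, so even a block that is not drawn enters the new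
    potential with \<open>G y\<close>.\<close>
  define U where "U i = v i + (\<gamma> i * \<eta> i) *\<^sub>R g i" for i
  define A where "A i = (norm (U i - (1 / pr i) *\<^sub>R D i))\<^sup>2 + \<sigma> i * (norm ((1 / pr i) *\<^sub>R D i))\<^sup>2" for i
  let ?P = "state_potential blk G \<eta> \<gamma> \<sigma> xstar"
  have step: "rcog_step blk G pr \<eta> \<gamma> i s = (y - (1 / pr i) *\<^sub>R D i, y)" for i
    by (simp add: rcog_step_def s D_def g_def h_def)
  have bD: "block blk i (D j) = (if i = j then D i else 0)" for i j
    by (simp add: D_def g_def h_def block_simps)
  have bU: "block blk i (y - (1 / pr j) *\<^sub>R D j - xstar + block_scale blk (\<lambda>i. \<gamma> i * \<eta> i) (G y))
      = (if i = j then U i - (1 / pr i) *\<^sub>R D i else U i)" for i j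
    by (simp add: block_add block_diff block_scaleR block_block_scale bD U_def v_def g_def)
  have P_step: "?P (rcog_step blk G pr \<eta> \<gamma> j s)
      = (\<Sum>i\<in>UNIV. (norm (U i))\<^sup>2) + (A j - (norm (U j))\<^sup>2)" for j
  proof -
    have "?P (rcog_step blk G pr \<eta> \<gamma> j s)
      = (\<Sum>i\<in>UNIV. (norm (if i = j then U i - (1 / pr i) *\<^sub>R D i else U i))\<^sup>2
          + \<sigma> i * (norm (if i = j then (1 / pr i) *\<^sub>R D i else 0))\<^sup>2)"
      unfolding state_potential_def step weighted_norm_sq_def fst_conv snd_conv
        norm_sq_eq_sum_block[of "_ + _" blk] bU sum.distrib[symmetric]
      by (intro sum.cong) (auto simp: block_simps bD)
    also have "\<dots> = (\<Sum>i\<in>UNIV. (norm (U i))\<^sup>2 + (if i = j then A i - (norm (U i))\<^sup>2 else 0))"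
      by (intro sum.cong) (auto simp: A_def)
    finally show ?thesis
      by (simp add: sum.distrib)
  qed
  have "(\<Sum>j\<in>UNIV. pr j * ?P (rcog_step blk G pr \<eta> \<gamma> j s))
      = (\<Sum>j\<in>UNIV. pr j) * (\<Sum>i\<in>UNIV. (norm (U i))\<^sup>2) + (\<Sum>j\<in>UNIV. pr j * (A j - (norm (U j))\<^sup>2))"
    unfolding P_step by (simp add: distrib_left sum.distrib sum_distrib_right)
  also have "\<dots> = (\<Sum>i\<in>UNIV. (norm (U i))\<^sup>2 + pr i * (A i - (norm (U i))\<^sup>2))"
    by (simp add: pr_sum sum.distrib)
  also have "\<dots> \<le> (\<Sum>i\<in>UNIV. (norm (v i + (\<gamma> i * \<eta> i) *\<^sub>R h i))\<^sup>2 + \<sigma> i * (norm (block blk i (y - z)))\<^sup>2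
      - psi pr \<eta> \<gamma> \<sigma> \<rho> i * (norm (g i))\<^sup>2)"
  proof (rule sum_mono)
    fix i
    have "- \<rho> i * (norm (g i))\<^sup>2 \<le> g i \<bullet> v i"
      unfolding g_def v_def by (rule block_weak_minty[OF lipschitz minty xstar])
    moreover have "(norm ((\<gamma> i * \<eta> i) *\<^sub>R (g i - h i)))\<^sup>2
        \<le> (kappa (\<sigma> i))\<^sup>2 * pr i * (norm (block blk i (y - z)))\<^sup>2"
      unfolding g_def h_def by (rule scaled_increment_le)
    ultimately show "(norm (U i))\<^sup>2 + pr i * (A i - (norm (U i))\<^sup>2)
        \<le> (norm (v i + (\<gamma> i * \<eta> i) *\<^sub>R h i))\<^sup>2 + \<sigma> i * (norm (block blk i (y - z)))\<^sup>2
          - psi pr \<eta> \<gamma> \<sigma> \<rho> i * (norm (g i))\<^sup>2"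
      unfolding A_def psi_def
      using gamma_range[of i] gamma_pos[of i] pr_pos[of i] sigma_pos[of i] eta_pos[of i]
      by (intro block_descent[OF _ _ _ _ _ _ _ U_def D_def]) auto
  qed
  also have "\<dots> = ?P s - (\<Sum>i\<in>UNIV. psi pr \<eta> \<gamma> \<sigma> \<rho> i * (norm (block blk i (G (fst s))))\<^sup>2)"
    unfolding state_potential_def weighted_norm_sq_def norm_sq_eq_sum_block[of "fst s - xstar + _" blk]
    by (simp add: s sum.distrib sum_subtractf block_add block_block_scale v_def h_def g_def)
  finally show ?thesis .
qed

text \<open>The weighted term is zero, both components being \<open>x0\<close>. Comparison with
  \<open>xstar\<close> bounds the squared norm of the operator term by \<open>1 / 2\<close> of the
  squared distance, as \<open>(kappa (\<sigma> i))^2 * pr i\<close> is at most \<open>1 / 2\<close>.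
  The constant is then at most 2 + 2/2 = 3.\<close>

lemma state_potential_init_le:
  "state_potential blk G \<eta> \<gamma> \<sigma> xstar (x0, x0) \<le> 3 * (norm (x0 - xstar))\<^sup>2"
proof -
  let ?e = "block_scale blk (\<lambda>i. \<gamma> i * \<eta> i) (G x0)"
  have "(norm (block blk i ?e))\<^sup>2 \<le> 1 / 2 * (norm (block blk i (x0 - xstar)))\<^sup>2" for i
  proof -
    have "pr i \<le> 1"
      using member_le_sum[of i UNIV pr] pr_pos pr_sum by (simp add: less_imp_le)
    moreover have "(kappa (\<sigma> i))\<^sup>2 \<le> 1 / 2"
      using sigma_pos[of i] by (simp add: kappa_sq field_simps)
    ultimately have "(kappa (\<sigma> i))\<^sup>2 * pr i \<le> 1 / 2 * 1"
      using pr_pos[of i] by (intro mult_mono) auto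
    then have "(kappa (\<sigma> i))\<^sup>2 * pr i * (norm (block blk i (x0 - xstar)))\<^sup>2
        \<le> 1 / 2 * (norm (block blk i (x0 - xstar)))\<^sup>2"
      by (intro mult_right_mono) auto
    with scaled_increment_le[of i x0 xstar] show ?thesis
      using xstar by (simp add: zer_def block_block_scale)
  qed
  then have "(norm ?e)\<^sup>2 \<le> (\<Sum>i\<in>UNIV. 1 / 2 * (norm (block blk i (x0 - xstar)))\<^sup>2)"
    unfolding norm_sq_eq_sum_block[of ?e blk] by (intro sum_mono)
  also have "\<dots> = 1 / 2 * (norm (x0 - xstar))\<^sup>2"
    by (simp add: norm_sq_eq_sum_block[of "x0 - xstar" blk] sum_divide_distrib)
  finally have "(norm (x0 - xstar + ?e))\<^sup>2 \<le> 3 * (norm (x0 - xstar))\<^sup>2"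
    using norm_add_sq_le[of "x0 - xstar" ?e] by linarith
  then show ?thesis
    by (simp add: state_potential_def weighted_norm_sq_def)
qed

text \<open>The factor before the bracket of \<open>psi\<close> is positive, and the bracket is
  \<open>\<eta> i * (1 - c) - \<rho> i / \<gamma> i\<close>, which increases in
  \<open>\<eta> i\<close> and vanishes at \<open>eta_low\<close>. Positivity is therefore a
  threshold on the step size.\<close>

lemma psi_pos_iff: "0 < psi pr \<eta> \<gamma> \<sigma> \<rho> i \<longleftrightarrow> eta_low pr \<gamma> \<sigma> \<rho> i < \<eta> i"
proof -
  define c where "c = (1 + \<sigma> i) * (1 - \<gamma> i) / (\<gamma> i * pr i)"
  have c: "0 < 1 - c"
    using optimism_ratio_less_1[of i] by (simp add: c_def)
  have "psi pr \<eta> \<gamma> \<sigma> \<rho> i = 2 * \<gamma> i * \<eta> i * (1 - \<gamma> i) * (\<eta> i - \<rho> i / \<gamma> i - \<eta> i * c)"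
    by (simp add: psi_def c_def)
  moreover have "0 < 2 * \<gamma> i * \<eta> i * (1 - \<gamma> i)"
    using gamma_range[of i] gamma_pos[of i] eta_pos[of i] by simp
  ultimately have "0 < psi pr \<eta> \<gamma> \<sigma> \<rho> i \<longleftrightarrow> 0 < \<eta> i - \<rho> i / \<gamma> i - \<eta> i * c"
    by (metis mult_pos_pos zero_less_mult_pos)
  also have "\<dots> \<longleftrightarrow> \<rho> i / \<gamma> i / (1 - c) < \<eta> i"
    using c by (subst pos_divide_less_eq) (auto simp: algebra_simps)
  also have "\<rho> i / \<gamma> i / (1 - c) = eta_low pr \<gamma> \<sigma> \<rho> i"
    by (simp add: eta_low_def c_def)
  finally show ?thesis .
qed

text \<open>The condition on \<open>L i * \<rho> i\<close>, divided by
  \<open>\<gamma> i * L i * (1 - c)\<close>, shows that some step sizes lie above the positivity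
  threshold and within the upper bound.\<close>

lemma eta_low_less_upper:
  assumes "0 < L i"
    and "L i * \<rho> i < kappa (\<sigma> i) * sqrt (pr i) * (1 - (1 + \<sigma> i) * (1 - \<gamma> i) / (\<gamma> i * pr i))"
  shows "eta_low pr \<gamma> \<sigma> \<rho> i < kappa (\<sigma> i) * sqrt (pr i) / (\<gamma> i * L i)"
proof -
  define c where "c = (1 + \<sigma> i) * (1 - \<gamma> i) / (\<gamma> i * pr i)"
  define q where "q = kappa (\<sigma> i) * sqrt (pr i)"
  have c: "0 < 1 - c"
    using optimism_ratio_less_1[of i] by (simp add: c_def)
  have "L i * \<rho> i < q * (1 - c)"
    using assms(2) by (simp add: c_def q_def)
  then have "\<rho> i / (\<gamma> i * (1 - c)) < q / (\<gamma> i * L i)"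
    using c assms(1) gamma_pos[of i] by (simp add: frac_less_eq pos_divide_less_eq pos_less_divide_eq mult_ac)
  then show ?thesis
    by (simp add: eta_low_def c_def q_def)
qed

end

section \<open>Expected descent and the averaged bounds\<close>

theorem theorem1:
  fixes M :: "'w measure"
    and I :: "nat \<Rightarrow> 'w \<Rightarrow> 'n::finite"
    and blk :: "'p::finite \<Rightarrow> 'n"
    and G :: "real ^ 'p \<Rightarrow> real ^ 'p"
    and L \<rho> \<sigma> \<gamma> \<eta> pr :: "'n \<Rightarrow> real"
    and x0 xstar :: "real ^ 'p"
    and x :: "nat \<Rightarrow> 'w \<Rightarrow> real ^ 'p"
  assumes L_nonneg: "\<And>i. 0 \<le> L i"
    and lipschitz: "block_lipschitz blk G L"
    and rho_range: "\<And>i. 0 \<le> \<rho> i \<and> \<rho> i \<le> L i"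
    and xstar: "xstar \<in> zer G"
    and minty: "weak_minty blk G \<rho> xstar"
    and pr_pos: "\<And>i. 0 < pr i"
    and pr_sum: "(\<Sum>i\<in>UNIV. pr i) = 1"
    and prob: "prob_space M"
    and indep: "prob_space.indep_vars M (\<lambda>_. count_space UNIV) I UNIV"
    and distr: "\<And>k i. measure M {\<omega> \<in> space M. I k \<omega> = i} = pr i"
    and scheme: "\<And>\<omega>. \<omega> \<in> space M \<Longrightarrow> rcog blk G pr \<eta> \<gamma> x0 (\<lambda>k. I k \<omega>) (\<lambda>k. x k \<omega>)"
    and sigma_pos: "\<And>i. 0 < \<sigma> i"
    and gamma_range: "\<And>i. (1 + \<sigma> i) / (1 + \<sigma> i + pr i) < \<gamma> i \<and> \<gamma> i < 1"
    and L_rho: "\<And>i. L i * \<rho> i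
       < kappa (\<sigma> i) * sqrt (pr i) * (1 - (1 + \<sigma> i) * (1 - \<gamma> i) / (\<gamma> i * pr i))"
    and eta_pos: "\<And>i. 0 < \<eta> i"
    \<comment> \<open>for L i = 0 the upper bound on the step size is infinite\<close>
    and eta_upper: "\<And>i. 0 < L i \<Longrightarrow> \<eta> i \<le> kappa (\<sigma> i) * sqrt (pr i) / (\<gamma> i * L i)"
  shows
    "(\<forall>k. (LINT \<omega>|M. potential blk G \<eta> \<gamma> \<sigma> xstar (\<lambda>m. x m \<omega>) (Suc k))
         \<le> (LINT \<omega>|M. potential blk G \<eta> \<gamma> \<sigma> xstar (\<lambda>m. x m \<omega>) k)
            - (\<Sum>i\<in>UNIV. psi pr \<eta> \<gamma> \<sigma> \<rho> i * (LINT \<omega>|M. (norm (block blk i (G (x k \<omega>))))\<^sup>2)))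
   \<and> (\<forall>i. 0 < psi pr \<eta> \<gamma> \<sigma> \<rho> i \<longleftrightarrow> eta_low pr \<gamma> \<sigma> \<rho> i < \<eta> i)
   \<and> (0 < Min (range (psi pr \<eta> \<gamma> \<sigma> \<rho>)) \<longleftrightarrow> (\<forall>i. eta_low pr \<gamma> \<sigma> \<rho> i < \<eta> i))
   \<and> (\<forall>i. 0 < L i \<longrightarrow> eta_low pr \<gamma> \<sigma> \<rho> i < kappa (\<sigma> i) * sqrt (pr i) / (\<gamma> i * L i))
   \<and> (\<forall>K. Min (range (psi pr \<eta> \<gamma> \<sigma> \<rho>)) / (real K + 1)
            * (\<Sum>k=0..K. LINT \<omega>|M. (norm (G (x k \<omega>)))\<^sup>2)
          \<le> 1 / (real K + 1)
            * (\<Sum>k=0..K. \<Sum>i\<in>UNIV. psi pr \<eta> \<gamma> \<sigma> \<rho> i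
                 * (LINT \<omega>|M. (norm (block blk i (G (x k \<omega>))))\<^sup>2))
        \<and> 1 / (real K + 1)
            * (\<Sum>k=0..K. \<Sum>i\<in>UNIV. psi pr \<eta> \<gamma> \<sigma> \<rho> i
                 * (LINT \<omega>|M. (norm (block blk i (G (x k \<omega>))))\<^sup>2))
          \<le> 3 * (norm (x0 - xstar))\<^sup>2 / (real K + 1))"
proof -
  interpret prob_space M by (rule prob)
  interpret rcog_parameters blk G L \<rho> \<sigma> \<gamma> \<eta> pr xstar
    using assms by unfold_locales auto
  let ?P = "state_potential blk G \<eta> \<gamma> \<sigma> xstar"
  let ?psi = "psi pr \<eta> \<gamma> \<sigma> \<rho>"
  \<comment> \<open>\<open>S\<close> is the random state along the given trajectory,
    \<open>T\<close> the same state as a function of the sampled indices.\<close>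
  define S where "S k \<omega> = (x k \<omega>, prev (\<lambda>m. x m \<omega>) k)" for k \<omega>
  define T where "T k b = rcog_state blk G pr \<eta> \<gamma> x0 b k" for k b
  have S_T: "S k \<omega> = T k (\<lambda>j\<in>{..<k}. I j \<omega>)" if "\<omega> \<in> space M" for k \<omega>
  proof -
    have "S k \<omega> = T k (\<lambda>j. I j \<omega>)"
      unfolding S_def T_def using rcog_state_eq[OF scheme[OF that]] by simp
    also have "\<dots> = T k (\<lambda>j\<in>{..<k}. I j \<omega>)"
      unfolding T_def by (rule rcog_state_cong) simp
    finally show ?thesis .
  qed
  have S_Suc: "S (Suc k) \<omega> = rcog_step blk G pr \<eta> \<gamma> (I k \<omega>) (S k \<omega>)" if "\<omega> \<in> space M" for k \<omega>
    unfolding S_def using rcog_state_eq[OF scheme[OF that]] by (metis rcog_state.simps(2))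
  have pot: "potential blk G \<eta> \<gamma> \<sigma> xstar (\<lambda>m. x m \<omega>) k = ?P (S k \<omega>)" for k \<omega>
    by (simp add: S_def potential_eq_state_potential)
  have I: "random_variable (count_space UNIV) (I j)" for j
    using indep by (simp add: indep_vars_def)
  \<comment> \<open>At a fixed time the state factors through a finite tuple of indices, so
    \<open>f\<close> can be arbitrary.\<close>
  have integ: "integrable M (\<lambda>\<omega>. f (S k \<omega>))" for f :: "_ \<Rightarrow> real" and k
    using integrable_past[where I = I and f = "\<lambda>b. f (T k b)" and k = k, OF I]
    by (rule Bochner_Integration.integrable_cong[THEN iffD1, rotated 2]) (auto simp: S_T)
  have E_step: "(LINT \<omega>|M. ?P (S (Suc k) \<omega>))
      = (\<Sum>i\<in>UNIV. pr i * (LINT \<omega>|M. ?P (rcog_step blk G pr \<eta> \<gamma> i (S k \<omega>))))" for k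
  proof -
    \<comment> \<open>Writing the state before the step through the past indices exposes its
      independence of \<open>I k\<close>.\<close>
    have "(LINT \<omega>|M. ?P (S (Suc k) \<omega>))
        = (LINT \<omega>|M. ?P (rcog_step blk G pr \<eta> \<gamma> (I k \<omega>) (T k (\<lambda>j\<in>{..<k}. I j \<omega>))))"
      by (intro Bochner_Integration.integral_cong) (simp_all add: S_Suc S_T[symmetric])
    also have "\<dots> = (\<Sum>i\<in>UNIV. prob {\<omega> \<in> space M. I k \<omega> = i}
        * (LINT \<omega>|M. ?P (rcog_step blk G pr \<eta> \<gamma> i (T k (\<lambda>j\<in>{..<k}. I j \<omega>)))))"
      by (rule expectation_fresh_index[OF indep])
    also have "\<dots> = (\<Sum>i\<in>UNIV. pr i * (LINT \<omega>|M. ?P (rcog_step blk G pr \<eta> \<gamma> i (S k \<omega>))))"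
      unfolding distr
      by (intro sum.cong refl arg_cong2[where f = "(*)"] Bochner_Integration.integral_cong)
         (simp_all add: S_T)
    finally show ?thesis .
  qed
  have decrease: "(LINT \<omega>|M. ?P (S (Suc k) \<omega>)) \<le> (LINT \<omega>|M. ?P (S k \<omega>))
      - (\<Sum>i\<in>UNIV. ?psi i * (LINT \<omega>|M. (norm (block blk i (G (x k \<omega>))))\<^sup>2))" for k
  proof -
    \<comment> \<open>The average over \<open>i\<close> is moved inside the integral, where the
      pointwise inequality \<open>state_potential_step_le\<close> applies.\<close>
    have "(LINT \<omega>|M. ?P (S (Suc k) \<omega>))
        = (LINT \<omega>|M. (\<Sum>i\<in>UNIV. pr i * ?P (rcog_step blk G pr \<eta> \<gamma> i (S k \<omega>))))"
      unfolding E_step by (simp add: integ[of "\<lambda>s. ?P (rcog_step blk G pr \<eta> \<gamma> _ s)"])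
    also have "\<dots> \<le> (LINT \<omega>|M. ?P (S k \<omega>)
        - (\<Sum>i\<in>UNIV. ?psi i * (norm (block blk i (G (fst (S k \<omega>)))))\<^sup>2))"
      by (intro integral_mono state_potential_step_le
          integ[of "\<lambda>s. \<Sum>i\<in>UNIV. pr i * ?P (rcog_step blk G pr \<eta> \<gamma> i s)"]
          integ[of "\<lambda>s. ?P s - (\<Sum>i\<in>UNIV. ?psi i * (norm (block blk i (G (fst s))))\<^sup>2)"])
    also have "\<dots> = (LINT \<omega>|M. ?P (S k \<omega>))
        - (\<Sum>i\<in>UNIV. ?psi i * (LINT \<omega>|M. (norm (block blk i (G (fst (S k \<omega>)))))\<^sup>2))"
      by (simp add: integ[of ?P] integ[of "\<lambda>s. (norm (block blk _ (G (fst s))))\<^sup>2"])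
    finally show ?thesis by (simp add: S_def)
  qed
  have E_norm: "(LINT \<omega>|M. (norm (G (x k \<omega>)))\<^sup>2)
      = (\<Sum>i\<in>UNIV. LINT \<omega>|M. (norm (block blk i (G (x k \<omega>))))\<^sup>2)" for k
    unfolding norm_sq_eq_sum_block[of "G _" blk]
    using integ[of "\<lambda>s. (norm (block blk _ (G (fst s))))\<^sup>2" k]
    by (intro Bochner_Integration.integral_sum) (simp add: S_def)
  \<comment> \<open>This is true whatever the sign of the minimum, since the expected squares it
    multiplies are nonnegative.\<close>
  have lower: "Min (range ?psi) * (LINT \<omega>|M. (norm (G (x k \<omega>)))\<^sup>2)
      \<le> (\<Sum>i\<in>UNIV. ?psi i * (LINT \<omega>|M. (norm (block blk i (G (x k \<omega>))))\<^sup>2))" for k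
    unfolding E_norm sum_distrib_left by (intro sum_mono mult_right_mono) auto
  \<comment> \<open>The sum has \<open>K + 1\<close> terms, so the last potential is the one at
    \<open>Suc K\<close>; being nonnegative, it is dropped in \<open>upper\<close>.\<close>
  have telescope: "(\<Sum>k=0..K. \<Sum>i\<in>UNIV. ?psi i * (LINT \<omega>|M. (norm (block blk i (G (x k \<omega>))))\<^sup>2))
      \<le> (LINT \<omega>|M. ?P (S 0 \<omega>)) - (LINT \<omega>|M. ?P (S (Suc K) \<omega>))" for K
  proof (induction K)
    case 0
    show ?case using decrease[of 0] by simp
  next
    case (Suc K)
    then show ?case using decrease[of "Suc K"] by simp
  qed
  have init: "(LINT \<omega>|M. ?P (S 0 \<omega>)) \<le> 3 * (norm (x0 - xstar))\<^sup>2"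
  proof -
    have "(LINT \<omega>|M. ?P (S 0 \<omega>)) = (LINT \<omega>|M. ?P (x0, x0))"
      by (intro Bochner_Integration.integral_cong) (simp_all add: S_T T_def)
    then show ?thesis using state_potential_init_le[of x0] by (simp add: prob_space)
  qed
  have nonneg: "0 \<le> (LINT \<omega>|M. ?P (S k \<omega>))" for k
    by (intro Bochner_Integration.integral_nonneg)
       (auto simp: state_potential_def weighted_norm_sq_def intro!: add_nonneg_nonneg sum_nonneg
         mult_nonneg_nonneg less_imp_le[OF sigma_pos])
  have upper: "(\<Sum>k=0..K. \<Sum>i\<in>UNIV. ?psi i * (LINT \<omega>|M. (norm (block blk i (G (x k \<omega>))))\<^sup>2))
      \<le> 3 * (norm (x0 - xstar))\<^sup>2" for K
    using telescope[of K] init nonneg[of "Suc K"] by linarith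
  have average_lower: "Min (range ?psi) / (real K + 1) * (\<Sum>k=0..K. LINT \<omega>|M. (norm (G (x k \<omega>)))\<^sup>2)
      \<le> 1 / (real K + 1) * (\<Sum>k=0..K. \<Sum>i\<in>UNIV. ?psi i
            * (LINT \<omega>|M. (norm (block blk i (G (x k \<omega>))))\<^sup>2))" for K
  proof -
    have "Min (range ?psi) * (\<Sum>k=0..K. LINT \<omega>|M. (norm (G (x k \<omega>)))\<^sup>2)
        \<le> (\<Sum>k=0..K. \<Sum>i\<in>UNIV. ?psi i * (LINT \<omega>|M. (norm (block blk i (G (x k \<omega>))))\<^sup>2))"
      unfolding sum_distrib_left[of "Min _"] by (intro sum_mono lower)
    then show ?thesis by (simp add: divide_right_mono)
  qed
  have average_upper: "1 / (real K + 1) * (\<Sum>k=0..K. \<Sum>i\<in>UNIV. ?psi i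
            * (LINT \<omega>|M. (norm (block blk i (G (x k \<omega>))))\<^sup>2))
      \<le> 3 * (norm (x0 - xstar))\<^sup>2 / (real K + 1)" for K
    using divide_right_mono[OF upper[of K], of "real K + 1"] by simp
  have psi_min: "0 < Min (range ?psi) \<longleftrightarrow> (\<forall>i. eta_low pr \<gamma> \<sigma> \<rho> i < \<eta> i)"
    by (simp add: psi_pos_iff)
  show ?thesis
    unfolding pot
    using decrease psi_pos_iff psi_min eta_low_less_upper[OF _ L_rho] average_lower average_upper
    by blast
qed

end
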